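(* Let $h,\alpha$ be independent exponentially distributed random variables with means $\Omega_h,\Omega_\alpha$, and for a transmit power $P_s$ put $\gamma_P=\dfrac{P_p h}{P_s\alpha+N_0}$. Let $P_s$ be subject to the two constraints $$P_{\text{out}}^{P}=\Pr\{B\log_2(1+\gamma_P)<r_p\}\le\theta_{th},\qquad P_s\le P_{\text{pk}}.$$ With $\gamma_{th}=2^{r_p/B}-1$, the outage probability is $$P_{\text{out}}^{P}=1-\frac{P_p\Omega_h}{\gamma_{th}P_s\Omega_\alpha+P_p\Omega_h}\exp\left(-\frac{N_0\gamma_{th}}{P_p\Omega_h}\right).$$ Substituting this expression into the outage constraint and combining with the peak power constraint yields the adaptive transmit power policy $$\mathcal{P}=\min\left\{\frac{P_p\Omega_h}{\gamma_{th}\Omega_\alpha}\,\chi^{+},\;P_{\text{pk}}\right\},\qquad \chi^{+}=\max\left\{\frac{1}{1-\theta_{th}}\exp\left(-\frac{N_0\gamma_{th}}{P_p\Omega_h}\right)-1,\;0\right\}.$$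
   Context: Setting: a secondary transmitter with power $P_s$ shares the licensed spectrum of a primary transmitter with power $P_p$; $N_0$ is the noise power, $B$ the system bandwidth, $r_p$ the primary network target transmission rate, $\theta_{th}$ the primary outage-probability threshold and $P_{\text{pk}}$ the peak (maximum) transmit power of the secondary transmitter. All these are constants. $h$ and $\alpha$ are the channel power gains (Rayleigh fading) of the primary transmitter to primary receiver link and of the secondary transmitter to primary receiver interference link; $\gamma_P$ is the signal-to-interference-plus-noise ratio at the primary receiver. An exponential random variable with mean $\Omega$ has density $\frac1\Omega e^{-x/\Omega}$ on $x\ge0$. $\mathcal{P}$ is the transmit power that the secondary transmitter then uses to transmit to its receiver. *)

theory Defs
  imports "HOL-Probability.Probability"
begin

definition sinr :: "real \<Rightarrow> real \<Rightarrow> real \<Rightarrow> real \<Rightarrow> real \<Rightarrow> real" where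
  "sinr Pp N0 Ps g a = Pp * g / (Ps * a + N0)"

definition outage_prob ::
  "'w measure \<Rightarrow> ('w \<Rightarrow> real) \<Rightarrow> ('w \<Rightarrow> real) \<Rightarrow> real \<Rightarrow> real \<Rightarrow> real \<Rightarrow> real \<Rightarrow> real \<Rightarrow> real" where
  "outage_prob M h \<alpha> Pp N0 B rp Ps =
     measure M {\<omega> \<in> space M. B * log 2 (1 + sinr Pp N0 Ps (h \<omega>) (\<alpha> \<omega>)) < rp}"

definition feasible_powers ::
  "'w measure \<Rightarrow> ('w \<Rightarrow> real) \<Rightarrow> ('w \<Rightarrow> real) \<Rightarrow> real \<Rightarrow> real \<Rightarrow> real \<Rightarrow> real \<Rightarrow> real \<Rightarrow> real \<Rightarrow> real set" where
  "feasible_powers M h \<alpha> Pp N0 B rp \<theta> Ppk =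
     {Ps. 0 \<le> Ps \<and> outage_prob M h \<alpha> Pp N0 B rp Ps \<le> \<theta> \<and> Ps \<le> Ppk}"

text \<open>
  The adaptive policy transmits at the largest power satisfying both constraints. The outage
  threshold may be exceeded by noise and fading alone, so that not even power 0 is feasible;
  the secondary transmitter then stays silent.
\<close>
definition is_adaptive_power :: "real set \<Rightarrow> real \<Rightarrow> bool" where
  "is_adaptive_power F P \<longleftrightarrow>
     (if F = {} then P = 0 else P \<in> F \<and> (\<forall>Q\<in>F. Q \<le> P))"

end

theory Submission
  imports Defs
begin

text \<open>
  Almost surely \<open>h\<close> and \<open>\<alpha>\<close> are nonnegative, and then the link is not in outage iff \<open>h\<close> is at
  least the affine function \<open>\<gamma>th * (Ps * \<alpha> + N0) / Pp\<close> of \<open>\<alpha>\<close>. Conditioning on \<open>\<alpha>\<close> turns the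
  probability of this event into a Laplace transform of \<open>\<alpha>\<close>. The resulting outage probability
  is increasing in \<open>Ps\<close>, and solving the outage constraint for \<open>Ps\<close> gives the policy.
\<close>

text \<open>The density has the antiderivative \<open>- exp (- (l * x))\<close>, which tends to 0 at
  infinity because \<open>l\<close> is positive, so only the value at \<open>a\<close>
  survives.\<close>

lemma (in prob_space) exponential_distributed_emeasure_ge:
  assumes D: "distributed M lborel X (exponential_density l)" and l: "0 < l" and a: "0 \<le> a"
  shows "emeasure M {\<omega>\<in>space M. a \<le> X \<omega>} = ennreal (exp (- (l * a)))"
proof -
  have "emeasure M {\<omega>\<in>space M. a \<le> X \<omega>} = emeasure M (X -` {a..} \<inter> space M)"
    by (intro arg_cong[where f = "emeasure M"]) auto
  also have "\<dots> = (\<integral>\<^sup>+x. ennreal (exponential_density l x) * indicator {a..} x \<partial>lborel)"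
    by (intro distributed_emeasure[OF D]) auto
  \<comment> \<open>Since \<open>a\<close> is nonnegative, \<open>{a..}\<close> lies in the support,
    and the zero branch of the density for negative arguments is never met.\<close>
  also have "\<dots> = (\<integral>\<^sup>+x. ennreal (l * exp (- (l * x))) * indicator {a..} x \<partial>lborel)"
    using a by (intro nn_integral_cong)
      (auto simp: exponential_density_def mult.commute split: split_indicator)
  also have "\<dots> = ennreal (0 - (- exp (- (l * a))))"
  proof (intro nn_integral_FTC_atLeast[where F = "\<lambda>x. - exp (- (l * x))"])
    have "filterlim (\<lambda>x. l * x) at_top at_top"
      using l by (intro filterlim_tendsto_pos_mult_at_top[OF tendsto_const]) (auto simp: filterlim_ident)
    then have "((\<lambda>x. exp (- (l * x))) \<longlongrightarrow> 0) at_top"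
      by (intro filterlim_compose[OF exp_at_bot]) (simp add: filterlim_uminus_at_bot)
    from tendsto_minus[OF this] show "((\<lambda>x. - exp (- (l * x))) \<longlongrightarrow> 0) at_top"
      by simp
  qed (use l in \<open>auto intro!: derivative_eq_intros\<close>)
  finally show ?thesis
    by simp
qed

text \<open>Exponential tilting: the weight \<open>exp (- (c * x))\<close> turns the density of rate
  \<open>l\<close> into a multiple of the density of rate \<open>l + c\<close>. As the latter has
  total mass 1, the transform is just the constant factor, and no integral has to be
  evaluated.\<close>

lemma (in prob_space) exponential_distributed_laplace:
  assumes D: "distributed M lborel X (exponential_density l)" and l: "0 < l" and c: "0 \<le> c"
  shows "(\<integral>\<^sup>+\<omega>. ennreal (exp (- (c * X \<omega>))) \<partial>M) = ennreal (l / (l + c))"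
proof -
  interpret E: prob_space "density lborel (exponential_density (l + c))"
    using l c by (intro prob_space_exponential_density) auto
  have tilt: "exponential_density l x * exp (- (c * x)) = l / (l + c) * exponential_density (l + c) x" for x
  proof -
    have "exp (- x * l) * exp (- (c * x)) = exp (- x * (l + c))"
      by (simp add: mult_exp_exp algebra_simps)
    then show ?thesis
      using l c by (simp add: exponential_density_def)
  qed
  have "(\<integral>\<^sup>+\<omega>. ennreal (exp (- (c * X \<omega>))) \<partial>M)
      = (\<integral>\<^sup>+x. ennreal (exponential_density l x) * ennreal (exp (- (c * x))) \<partial>lborel)"
    by (intro distributed_nn_integral[OF D, symmetric]) auto
  also have "\<dots> = (\<integral>\<^sup>+x. ennreal (l / (l + c)) * ennreal (exponential_density (l + c) x) \<partial>lborel)"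
    using l c by (intro nn_integral_cong) (simp add: ennreal_mult'[symmetric] tilt)
  also have "\<dots> = ennreal (l / (l + c)) * emeasure (density lborel (exponential_density (l + c))) UNIV"
    by (simp add: nn_integral_cmult emeasure_density)
  also have "\<dots> = ennreal (l / (l + c))"
    using E.emeasure_space_1 by simp
  finally show ?thesis .
qed

lemma (in prob_space) exponential_distributed_AE_nonneg:
  assumes D: "distributed M lborel X (exponential_density l)"
  shows "AE \<omega> in M. 0 \<le> X \<omega>"
  by (subst distributed_AE2[OF D]) (auto simp: exponential_density_def)

text \<open>By independence and Fubini, \<open>X\<close> is integrated out first for a fixed value
  \<open>y\<close> of \<open>Y\<close>. The tail at \<open>a + b * y\<close> splits into a constant
  and \<open>exp (- ((k * b) * y))\<close>, so what remains is the Laplace transform of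
  \<open>Y\<close> at \<open>k * b\<close>.\<close>

lemma (in prob_space) exponential_affine_tail:
  assumes X: "distributed M lborel X (exponential_density k)" and k: "0 < k"
    and Y: "distributed M lborel Y (exponential_density l)" and l: "0 < l"
    and ind: "indep_var borel X borel Y" and a: "0 \<le> a" and b: "0 \<le> b"
  shows "prob {\<omega>\<in>space M. a + b * Y \<omega> \<le> X \<omega>} = exp (- (k * a)) * (l / (l + k * b))"
proof -
  have [measurable]: "X \<in> borel_measurable M" "Y \<in> borel_measurable M"
    using distributed_measurable[OF X] distributed_measurable[OF Y] by simp_all
  interpret DX: prob_space "distr M borel X" by (rule prob_space_distr) simp
  interpret DY: prob_space "distr M borel Y" by (rule prob_space_distr) simp
  interpret DXY: pair_sigma_finite "distr M borel X" "distr M borel Y" ..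
  define A where "A = {p :: real \<times> real. a + b * snd p \<le> fst p}"
  have "{p \<in> space (borel \<Otimes>\<^sub>M borel). a + b * snd p \<le> fst p} \<in> sets (borel \<Otimes>\<^sub>M borel)"
    by measurable
  then have A: "A \<in> sets (borel \<Otimes>\<^sub>M borel)"
    by (simp add: A_def space_pair_measure)
  have "emeasure M {\<omega>\<in>space M. a + b * Y \<omega> \<le> X \<omega>}
      = emeasure (distr M (borel \<Otimes>\<^sub>M borel) (\<lambda>\<omega>. (X \<omega>, Y \<omega>))) A"
    by (subst emeasure_distr[OF _ A]) (auto simp: A_def intro!: arg_cong[where f = "emeasure M"])
  \<comment> \<open>Independence enters here: the joint law is the product of the marginals.\<close>
  also have "\<dots> = emeasure (distr M borel X \<Otimes>\<^sub>M distr M borel Y) A"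
    using ind by (simp add: indep_var_distribution_eq)
  also have "\<dots> = (\<integral>\<^sup>+y. emeasure (distr M borel X) ((\<lambda>x. (x, y)) -` A) \<partial>distr M borel Y)"
    by (intro DXY.emeasure_pair_measure_alt2) (use A in simp)
  also have "\<dots> = (\<integral>\<^sup>+y. emeasure (distr M borel X) {a + b * y..} \<partial>distr M borel Y)"
    by (intro nn_integral_cong arg_cong2[where f = emeasure]) (auto simp: A_def)
  also have "\<dots> = (\<integral>\<^sup>+y. ennreal (exp (- (k * (a + b * y)))) \<partial>distr M borel Y)"
  \<comment> \<open>The tail formula requires a nonnegative threshold \<open>a + b * y\<close>. This
    is guaranteed for \<open>0 \<le> y\<close>, hence for almost every \<open>y\<close> under the
    law of \<open>Y\<close>.\<close>
  proof (rule nn_integral_cong_AE)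
    have "AE y in distr M borel Y. 0 \<le> y"
      using exponential_distributed_AE_nonneg[OF Y] by (simp add: AE_distr_iff)
    then show "AE y in distr M borel Y.
        emeasure (distr M borel X) {a + b * y..} = ennreal (exp (- (k * (a + b * y))))"
    proof eventually_elim
      case (elim y)
      have "emeasure (distr M borel X) {a + b * y..} = emeasure M {\<omega>\<in>space M. a + b * y \<le> X \<omega>}"
        by (subst emeasure_distr) (auto intro!: arg_cong[where f = "emeasure M"])
      also have "\<dots> = ennreal (exp (- (k * (a + b * y))))"
        using a b elim by (intro exponential_distributed_emeasure_ge[OF X k]) simp
      finally show ?case .
    qed
  qed
  also have "\<dots> = (\<integral>\<^sup>+\<omega>. ennreal (exp (- (k * a))) * ennreal (exp (- ((k * b) * Y \<omega>))) \<partial>M)"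
    by (subst nn_integral_distr)
      (auto simp: ennreal_mult'[symmetric] mult_exp_exp algebra_simps intro!: nn_integral_cong)
  also have "\<dots> = ennreal (exp (- (k * a))) * ennreal (l / (l + k * b))"
    using exponential_distributed_laplace[OF Y l, of "k * b"] k b by (simp add: nn_integral_cmult)
  also have "\<dots> = ennreal (exp (- (k * a)) * (l / (l + k * b)))"
    by (rule ennreal_mult'[symmetric]) simp
  finally show ?thesis
    using k l b by (simp add: measure_def)
qed

lemma rate_less_iff_sinr_less:
  fixes B r s :: real
  assumes "0 < B" "0 \<le> s"
  shows "B * log 2 (1 + s) < r \<longleftrightarrow> s < 2 powr (r / B) - 1"
proof -
  have "B * log 2 (1 + s) < r \<longleftrightarrow> log 2 (1 + s) < r / B"
    using assms by (simp add: pos_less_divide_eq mult.commute)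
  also have "\<dots> \<longleftrightarrow> 1 + s < 2 powr (r / B)"
    using assms by (simp add: log_less_iff)
  finally show ?thesis
    by auto
qed

text \<open>The complement of the outage event is, up to a null set, the event of
  \<open>exponential_affine_tail\<close> with \<open>h\<close> as \<open>X\<close>,
  \<open>\<alpha>\<close> as \<open>Y\<close> and the reciprocal means as rates.\<close>

lemma outage_prob_exponential:
  assumes "prob_space M"
    and \<Omega>: "0 < \<Omega>h" "0 < \<Omega>\<alpha>"
    and h: "distributed M lborel h (exponential_density (1 / \<Omega>h))"
    and \<alpha>: "distributed M lborel \<alpha> (exponential_density (1 / \<Omega>\<alpha>))"
    and ind: "prob_space.indep_var M borel h borel \<alpha>"
    and pos: "0 < Pp" "0 < N0" "0 < B" "0 \<le> rp" "0 \<le> Ps"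
    and \<gamma>: "\<gamma>th = 2 powr (rp / B) - 1"
  shows "outage_prob M h \<alpha> Pp N0 B rp Ps =
    1 - Pp * \<Omega>h / (\<gamma>th * Ps * \<Omega>\<alpha> + Pp * \<Omega>h) * exp (- (N0 * \<gamma>th / (Pp * \<Omega>h)))"
proof -
  interpret prob_space M by fact
  have [measurable]: "h \<in> borel_measurable M" "\<alpha> \<in> borel_measurable M"
    using distributed_measurable[OF h] distributed_measurable[OF \<alpha>] by simp_all
  have \<gamma>0: "0 \<le> \<gamma>th"
    using pos \<gamma> by (simp add: ge_one_powr_ge_zero)
  \<comment> \<open>Intercept and slope obtained by solving
    \<open>sinr Pp N0 Ps h \<alpha> = \<gamma>th\<close> for the gain \<open>h\<close>.\<close>
  define a b where "a = \<gamma>th * N0 / Pp" and "b = \<gamma>th * Ps / Pp"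
  have ab: "0 \<le> a" "0 \<le> b"
    using \<gamma>0 pos by (auto simp: a_def b_def)
  \<comment> \<open>Only almost sure: negative gains could make the denominator of the SINR or the
    argument of \<open>log\<close> nonpositive, and then the inequalities cannot be
    transformed.\<close>
  have "AE \<omega> in M. B * log 2 (1 + sinr Pp N0 Ps (h \<omega>) (\<alpha> \<omega>)) < rp \<longleftrightarrow> \<not> a + b * \<alpha> \<omega> \<le> h \<omega>"
    using exponential_distributed_AE_nonneg[OF h] exponential_distributed_AE_nonneg[OF \<alpha>]
  proof eventually_elim
    case (elim \<omega>)
    have d: "0 < Ps * \<alpha> \<omega> + N0"
      using elim pos by (simp add: add_nonneg_pos)
    have "0 \<le> sinr Pp N0 Ps (h \<omega>) (\<alpha> \<omega>)"
      using elim pos d by (simp add: sinr_def)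
    then have "B * log 2 (1 + sinr Pp N0 Ps (h \<omega>) (\<alpha> \<omega>)) < rp \<longleftrightarrow> sinr Pp N0 Ps (h \<omega>) (\<alpha> \<omega>) < \<gamma>th"
      using rate_less_iff_sinr_less[OF \<open>0 < B\<close>] \<gamma> by simp
    also have "\<dots> \<longleftrightarrow> Pp * h \<omega> < \<gamma>th * (Ps * \<alpha> \<omega> + N0)"
      unfolding sinr_def using d by (rule pos_divide_less_eq)
    also have "\<dots> \<longleftrightarrow> h \<omega> < a + b * \<alpha> \<omega>"
      using pos by (simp add: a_def b_def field_simps)
    finally show ?case by auto
  qed
  then have "outage_prob M h \<alpha> Pp N0 B rp Ps = prob {\<omega>\<in>space M. \<not> a + b * \<alpha> \<omega> \<le> h \<omega>}"
    unfolding outage_prob_def sinr_def by (intro finite_measure_eq_AE) auto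
  also have "\<dots> = 1 - prob {\<omega>\<in>space M. a + b * \<alpha> \<omega> \<le> h \<omega>}"
    by (rule prob_neg) measurable
  also have "\<dots> = 1 - exp (- (1 / \<Omega>h * a)) * (1 / \<Omega>\<alpha> / (1 / \<Omega>\<alpha> + 1 / \<Omega>h * b))"
    using \<Omega> by (simp only: exponential_affine_tail[OF h _ \<alpha> _ ind ab] zero_less_divide_1_iff)
  also have "1 / \<Omega>h * a = N0 * \<gamma>th / (Pp * \<Omega>h)"
    by (simp add: a_def mult.commute)
  also have "1 / \<Omega>\<alpha> / (1 / \<Omega>\<alpha> + 1 / \<Omega>h * b) = Pp * \<Omega>h / (\<gamma>th * Ps * \<Omega>\<alpha> + Pp * \<Omega>h)"
  proof -
    have "0 < \<gamma>th * Ps * \<Omega>\<alpha> + Pp * \<Omega>h" "0 < 1 / \<Omega>\<alpha> + 1 / \<Omega>h * b"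
      using \<gamma>0 pos \<Omega> ab by (simp_all add: add_nonneg_pos add_pos_nonneg)
    then show ?thesis
      using \<Omega> pos by (simp add: b_def divide_simps)
  qed
  finally show ?thesis by (simp add: mult.commute)
qed

text \<open>Both \<open>c * P + A\<close> and \<open>1 - \<theta>\<close> are positive, so clearing
  denominators preserves the direction and leaves an inequality linear in \<open>P\<close>. The
  resulting bound is the power level of the policy before clipping.\<close>

lemma hyperbolic_outage_le_iff:
  fixes A c e \<theta> P :: real
  assumes "0 < A" "0 < c" "\<theta> < 1" "0 \<le> P"
  shows "1 - A / (c * P + A) * e \<le> \<theta> \<longleftrightarrow> P \<le> A / c * (1 / (1 - \<theta>) * e - 1)"
proof -
  have d: "0 < c * P + A"
    using assms by (simp add: add_nonneg_pos)
  have "1 - A / (c * P + A) * e \<le> \<theta> \<longleftrightarrow> 1 - \<theta> \<le> A * e / (c * P + A)"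
    by auto
  also have "\<dots> \<longleftrightarrow> (1 - \<theta>) * (c * P + A) \<le> A * e"
    using d by (rule pos_le_divide_eq)
  also have "\<dots> \<longleftrightarrow> c * P + A \<le> A * e / (1 - \<theta>)"
    using assms by (simp add: pos_le_divide_eq mult.commute)
  also have "\<dots> \<longleftrightarrow> P * c \<le> A * (1 / (1 - \<theta>) * e - 1)"
    by (auto simp: algebra_simps)
  also have "\<dots> \<longleftrightarrow> P \<le> A * (1 / (1 - \<theta>) * e - 1) / c"
    using assms by (simp add: pos_le_divide_eq)
  finally show ?thesis
    by simp
qed

text \<open>For \<open>0 \<le> p\<close> the set is a closed interval with maximum
  \<open>min p q\<close>. For negative \<open>p\<close> it is empty, and the default power 0 agrees
  with the right-hand side because \<open>max p 0 = 0\<close> and \<open>0 \<le> q\<close>. Thus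
  clipping at 0 encodes the silent transmitter.\<close>

lemma is_adaptive_power_Icc:
  assumes "0 \<le> q"
  shows "is_adaptive_power {Q. 0 \<le> Q \<and> Q \<le> p \<and> Q \<le> q} P \<longleftrightarrow> P = min (max p 0) q"
proof (cases "0 \<le> p")
  case True
  then have "0 \<in> {Q. 0 \<le> Q \<and> Q \<le> p \<and> Q \<le> q}"
    using assms by simp
  then have "{Q. 0 \<le> Q \<and> Q \<le> p \<and> Q \<le> q} \<noteq> {}"
    by blast
  then show ?thesis
    using True assms by (auto simp: is_adaptive_power_def intro!: antisym)
next
  case False
  then have "{Q. 0 \<le> Q \<and> Q \<le> p \<and> Q \<le> q} = {}"
    by auto
  then show ?thesis
    using False assms by (simp add: is_adaptive_power_def)
qed

theorem mainTheorem1: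
  fixes M :: "'w measure"
    and h \<alpha> :: "'w \<Rightarrow> real"
    and \<Omega>h \<Omega>\<alpha> Pp N0 B rp \<theta>th Ppk \<gamma>th \<chi>plus :: real
  assumes "prob_space M"
    and "0 < \<Omega>h" and "0 < \<Omega>\<alpha>"
    and "distributed M lborel h (exponential_density (1 / \<Omega>h))"
    and "distributed M lborel \<alpha> (exponential_density (1 / \<Omega>\<alpha>))"
    and "prob_space.indep_var M borel h borel \<alpha>"
    and "0 < Pp" and "0 < N0" and "0 < B" and "0 < rp"
    and "0 \<le> \<theta>th" and "\<theta>th < 1" and "0 \<le> Ppk"
    and "\<gamma>th = 2 powr (rp / B) - 1"
    and "\<chi>plus = max (1 / (1 - \<theta>th) * exp (- (N0 * \<gamma>th / (Pp * \<Omega>h))) - 1) 0"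
  shows "(\<forall>Ps\<ge>0. outage_prob M h \<alpha> Pp N0 B rp Ps =
            1 - Pp * \<Omega>h / (\<gamma>th * Ps * \<Omega>\<alpha> + Pp * \<Omega>h) * exp (- (N0 * \<gamma>th / (Pp * \<Omega>h))))
       \<and> (\<forall>P. is_adaptive_power (feasible_powers M h \<alpha> Pp N0 B rp \<theta>th Ppk) P \<longleftrightarrow>
            P = min (Pp * \<Omega>h / (\<gamma>th * \<Omega>\<alpha>) * \<chi>plus) Ppk)"
proof -
  define A c e where "A = Pp * \<Omega>h" and "c = \<gamma>th * \<Omega>\<alpha>" and "e = exp (- (N0 * \<gamma>th / (Pp * \<Omega>h)))"
  \<comment> \<open>Strict positivity of \<open>rp\<close> gives \<open>0 < \<gamma>th\<close>,
    hence \<open>0 < c\<close>, so the outage constraint really bounds the power and division by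
    \<open>c\<close> is legitimate.\<close>
  have "1 < 2 powr (rp / B)"
    using assms by (simp add: powr_less_cancel_iff[of 2 0, simplified])
  then have pos: "0 < A" "0 < c"
    using assms by (simp_all add: A_def c_def)
  have out: "outage_prob M h \<alpha> Pp N0 B rp Ps =
      1 - Pp * \<Omega>h / (\<gamma>th * Ps * \<Omega>\<alpha> + Pp * \<Omega>h) * exp (- (N0 * \<gamma>th / (Pp * \<Omega>h)))"
    if "0 \<le> Ps" for Ps
    using assms that by (intro outage_prob_exponential) auto
  then have "outage_prob M h \<alpha> Pp N0 B rp Ps \<le> \<theta>th \<longleftrightarrow> Ps \<le> A / c * (1 / (1 - \<theta>th) * e - 1)"
    if "0 \<le> Ps" for Ps
    using hyperbolic_outage_le_iff[OF pos \<open>\<theta>th < 1\<close> that, of e] that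
    by (simp add: A_def c_def e_def mult_ac)
  then have F: "feasible_powers M h \<alpha> Pp N0 B rp \<theta>th Ppk =
      {Q. 0 \<le> Q \<and> Q \<le> A / c * (1 / (1 - \<theta>th) * e - 1) \<and> Q \<le> Ppk}"
    unfolding feasible_powers_def by (intro Collect_cong) blast
  \<comment> \<open>The positive factor \<open>A / c\<close> can be pulled out of the maximum, so
    clipping the power at 0 is the same as clipping the bracket, which is
    \<open>\<chi>plus\<close>.\<close>
  have "max (A / c * (1 / (1 - \<theta>th) * e - 1)) 0 = A / c * \<chi>plus"
    using pos assms by (simp add: max_mult_distrib_left e_def)
  then have "is_adaptive_power (feasible_powers M h \<alpha> Pp N0 B rp \<theta>th Ppk) P \<longleftrightarrow>
      P = min (Pp * \<Omega>h / (\<gamma>th * \<Omega>\<alpha>) * \<chi>plus) Ppk" for P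
    unfolding F is_adaptive_power_Icc[OF \<open>0 \<le> Ppk\<close>] by (simp add: A_def c_def)
  with out show ?thesis
    by blast
qed

end
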